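(* Let $\omega\in\mathbb{R}$ with $\omega\geqslant\sqrt{3}$, let $m\in\{0,1,2,\dots\}$, and let $r':=\left\lfloor\frac{m+2}{\omega+1}\right\rfloor$. Let $r_0$ be the integer in $\{0,1,\dots,m\}$ determined by $$g(-1)<\cdots<g(r_0-1)\leqslant g(r_0)\quad\text{and}\quad g(r_0)>\cdots>g(m+1).$$ Then $r_0\in\{r',r'+1\}$, that is, $$g(0)<\cdots<g(r'-1)\leqslant g(r')\quad\text{and}\quad g(r'+1)>g(r'+2)>\cdots>g(m).$$
   Context: For integers $0\leqslant r\leqslant m$, $s_m(r)=\sum_{i=0}^r\binom{m}{i}$ and $g(r)=g_{\omega,m}(r)=\omega^{-r}s_m(r)$. The domain of $g$ is extended by $g(-1)=0$ and $g(m+1)=g(m)/\omega$. For $\omega>1$ the function $g$ is unimodal and the integer $r_0$ defined by the displayed chains exists and is unique (it is the largest maximizing input of $g$ on $\{0,\dots,m\}$). In a chain such as $g(0)<\cdots<g(r'-1)\leqslant g(r')$, the strict inequalities are between consecutive arguments up to $r'-1$, followed by the single inequality $g(r'-1)\leqslant g(r')$; a chain $g(r'+1)>\cdots>g(m)$ is vacuous if $r'+1\geqslant m$. *)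

theory Defs
  imports Complex_Main
begin

definition binom_psum :: "nat \<Rightarrow> nat \<Rightarrow> nat" where
  "binom_psum m r = (\<Sum>i\<le>r. m choose i)"

text \<open>
  The argument is an integer because the domain is \<open>{-1..m + 1}\<close>. The last branch supplies
  \<open>g(-1) = 0\<close>; the value \<open>0\<close> elsewhere outside the domain is irrelevant.
\<close>

definition g :: "real \<Rightarrow> nat \<Rightarrow> int \<Rightarrow> real" where
  "g \<omega> m r =
     (if 0 \<le> r \<and> r \<le> int m then \<omega> powi (- r) * real (binom_psum m (nat r))
      else if r = int m + 1 then (\<omega> powi (- int m) * real (binom_psum m m)) / \<omega>
      else 0)"

text \<open>
  \<open>rising_chain f a r\<close> is \<open>f a < \<dots> < f (r - 1) \<le> f r\<close> and \<open>falling_chain f r b\<close> is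
  \<open>f r > \<dots> > f b\<close>. The strict parts are vacuous when \<open>r - 1 \<le> a\<close> and \<open>b \<le> r\<close> respectively,
  whereas \<open>f (r - 1) \<le> f r\<close> is always asserted.
\<close>

definition rising_chain :: "(int \<Rightarrow> real) \<Rightarrow> int \<Rightarrow> int \<Rightarrow> bool" where
  "rising_chain f a r \<longleftrightarrow> (\<forall>i\<in>{a..<r - 1}. f i < f (i + 1)) \<and> f (r - 1) \<le> f r"

definition falling_chain :: "(int \<Rightarrow> real) \<Rightarrow> int \<Rightarrow> int \<Rightarrow> bool" where
  "falling_chain f r b \<longleftrightarrow> (\<forall>i\<in>{r..<b}. f i > f (i + 1))"

definition is_peak :: "real \<Rightarrow> nat \<Rightarrow> int \<Rightarrow> bool" where
  "is_peak \<omega> m r\<^sub>0 \<longleftrightarrow> r\<^sub>0 \<in> {0..int m} \<and>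
     rising_chain (g \<omega> m) (-1) r\<^sub>0 \<and> falling_chain (g \<omega> m) r\<^sub>0 (int m + 1)"

lemma binom_psum_pos: "binom_psum m r > 0"
proof -
  have "m choose 0 \<le> binom_psum m r"
    unfolding binom_psum_def by (rule member_le_sum) auto
  then show ?thesis by simp
qed

lemma binom_psum_Suc: "binom_psum m (Suc r) = binom_psum m r + (m choose Suc r)"
  by (simp add: binom_psum_def)

lemma choose_cross_le:
  assumes "i \<le> k"
  shows "(m choose Suc k) * (m choose i) \<le> (m choose k) * (m choose Suc i)"
proof (cases "k < m")
  case True
  have absorb: "Suc j * (m choose Suc j) = (m - j) * (m choose j)" for j
    by (simp only: binomial_absorption binomial_absorb_comp)
  have "Suc k * Suc i * ((m choose Suc k) * (m choose i))
      = (Suc i * (m - k)) * ((m choose k) * (m choose i))"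
    using absorb[of k] by (metis mult.assoc mult.commute)
  also have "\<dots> \<le> (Suc k * (m - i)) * ((m choose k) * (m choose i))"
    using assms by (intro mult_right_mono mult_mono) auto
  also have "\<dots> = Suc k * Suc i * ((m choose k) * (m choose Suc i))"
    using absorb[of i] by (metis mult.assoc mult.commute)
  finally show ?thesis by (simp del: binomial_Suc_Suc mult_Suc)
next
  case False
  then show ?thesis by (simp add: binomial_eq_0)
qed

lemma binom_psum_cross_less:
  assumes "k \<le> m" "0 < k"
  shows "(m choose Suc k) * binom_psum m (k - 1) < (m choose k) * binom_psum m k"
proof -
  obtain j where k: "k = Suc j" using assms by (cases k) auto
  have "(m choose Suc k) * binom_psum m (k - 1) = (\<Sum>i\<le>j. (m choose Suc k) * (m choose i))"
    by (simp add: binom_psum_def k sum_distrib_left del: binomial_Suc_Suc)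
  also have "\<dots> \<le> (\<Sum>i\<le>j. (m choose k) * (m choose Suc i))"
    by (intro sum_mono choose_cross_le) (auto simp: k)
  also have "\<dots> < (m choose k) * (1 + (\<Sum>i\<le>j. m choose Suc i))"
    using assms by (simp add: sum_distrib_left algebra_simps del: binomial_Suc_Suc)
  also have "1 + (\<Sum>i\<le>j. m choose Suc i) = binom_psum m k"
    unfolding binom_psum_def k sum.atMost_Suc_shift by simp
  finally show ?thesis .
qed

lemma g_of_nat:
  assumes "\<omega> > 0" "r \<le> Suc m"
  shows "g \<omega> m (int r) = real (binom_psum m r) / \<omega> ^ r"
proof (cases "r = Suc m")
  case True
  then show ?thesis
    using assms by (simp add: g_def binom_psum_Suc power_int_minus field_simps)
next
  case False
  then show ?thesis
    using assms by (simp add: g_def power_int_minus field_simps)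
qed

lemma g_diff_Suc:
  assumes "\<omega> > 0" "r \<le> m"
  shows "g \<omega> m (int r) - g \<omega> m (int r + 1)
    = ((\<omega> - 1) * real (binom_psum m r) - real (m choose Suc r)) / \<omega> ^ Suc r"
proof -
  have "g \<omega> m (int r + 1) = real (binom_psum m (Suc r)) / \<omega> ^ Suc r"
    using g_of_nat[of \<omega> "Suc r" m] assms by (simp add: add.commute)
  moreover have "g \<omega> m (int r) = \<omega> * real (binom_psum m r) / \<omega> ^ Suc r"
    using g_of_nat[of \<omega> r m] assms by simp
  ultimately show ?thesis
    unfolding binom_psum_Suc of_nat_add by (simp add: diff_divide_distrib[symmetric] algebra_simps
        del: power_Suc binomial_Suc_Suc)
qed

lemma g_Suc_less_iff:
  assumes "\<omega> > 0" "r \<le> m"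
  shows "g \<omega> m (int r + 1) < g \<omega> m (int r)
    \<longleftrightarrow> real (m choose Suc r) < (\<omega> - 1) * real (binom_psum m r)"
proof -
  have "\<omega> ^ Suc r > 0" using assms by simp
  then have "0 < g \<omega> m (int r) - g \<omega> m (int r + 1)
      \<longleftrightarrow> 0 < (\<omega> - 1) * real (binom_psum m r) - real (m choose Suc r)"
    unfolding g_diff_Suc[OF assms] by (simp only: pos_less_divide_eq mult_zero_left)
  then show ?thesis by (simp only: diff_gt_0_iff_gt)
qed

lemma g_Suc_le_iff:
  assumes "\<omega> > 0" "r \<le> m"
  shows "g \<omega> m (int r + 1) \<le> g \<omega> m (int r)
    \<longleftrightarrow> real (m choose Suc r) \<le> (\<omega> - 1) * real (binom_psum m r)"
proof -
  have "\<omega> ^ Suc r > 0" using assms by simp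
  then have "0 \<le> g \<omega> m (int r) - g \<omega> m (int r + 1)
      \<longleftrightarrow> 0 \<le> (\<omega> - 1) * real (binom_psum m r) - real (m choose Suc r)"
    unfolding g_diff_Suc[OF assms] by (simp only: pos_le_divide_eq mult_zero_left)
  then show ?thesis by (simp only: diff_ge_0_iff_ge)
qed

lemma g_descent_step:
  assumes "\<omega> > 1" "r < m" "g \<omega> m (int r + 1) \<le> g \<omega> m (int r)"
  shows "g \<omega> m (int (Suc r) + 1) < g \<omega> m (int (Suc r))"
proof -
  let ?s = "real (binom_psum m r)" and ?s' = "real (binom_psum m (Suc r))"
  have pos: "?s > 0" using binom_psum_pos by simp
  have 1: "real (m choose Suc r) \<le> (\<omega> - 1) * ?s"
    using assms g_Suc_le_iff[of \<omega> r m] by (simp del: binomial_Suc_Suc)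
  have "(m choose Suc (Suc r)) * binom_psum m r < (m choose Suc r) * binom_psum m (Suc r)"
    using binom_psum_cross_less[of "Suc r" m] assms by (simp del: binomial_Suc_Suc)
  then have "real (m choose Suc (Suc r)) * ?s < real (m choose Suc r) * ?s'"
    by (metis of_nat_less_iff of_nat_mult)
  also have "\<dots> \<le> ((\<omega> - 1) * ?s) * ?s'"
    using 1 by (intro mult_right_mono) auto
  finally have "real (m choose Suc (Suc r)) * ?s < ((\<omega> - 1) * ?s') * ?s"
    by (simp add: ac_simps del: binomial_Suc_Suc)
  then have "real (m choose Suc (Suc r)) < (\<omega> - 1) * ?s'"
    using pos mult_less_cancel_right_pos by blast
  then show ?thesis
    using g_Suc_less_iff[of \<omega> "Suc r" m] assms by simp
qed

lemma is_peak_ex1: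
  assumes "\<omega> > 1"
  shows "\<exists>!r\<^sub>0. is_peak \<omega> m r\<^sub>0"
proof (rule ex_ex1I)
  define D where "D r \<longleftrightarrow> g \<omega> m (int r + 1) < g \<omega> m (int r)" for r
  define n where "n = (LEAST r. D r)"
  have Dm: "D m"
    using g_Suc_less_iff[of \<omega> m m] assms binom_psum_pos[of m m] by (simp add: D_def binomial_eq_0)
  have Dn: "D n" unfolding n_def by (rule LeastI[of D, OF Dm])
  have nm: "n \<le> m" unfolding n_def by (rule Least_le[of D, OF Dm])
  have least: "\<not> D r" if "r < n" for r
    using that not_less_Least unfolding n_def by blast
  have fall: "D r" if "n \<le> r" "r \<le> m" for r
    using that
  proof (induction r rule: dec_induct)
    case base
    show ?case by (rule Dn)
  next
    case (step r)
    then show ?case using g_descent_step[of \<omega> r m] assms unfolding D_def by simp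
  qed
  have strict: "g \<omega> m (int r) < g \<omega> m (int r + 1)" if "Suc r < n" for r
  proof (rule ccontr)
    assume "\<not> ?thesis"
    then have "D (Suc r)"
      using g_descent_step[of \<omega> r m] assms that nm unfolding D_def by simp
    with least that show False by blast
  qed
  have g0: "g \<omega> m (-1) < g \<omega> m 0"
    by (simp add: g_def binom_psum_def)
  have "g \<omega> m i < g \<omega> m (i + 1)" if "i \<in> {-1..<int n - 1}" for i
  proof (cases "i = -1")
    case True
    then show ?thesis using g0 by simp
  next
    case False
    then have "int (nat i) = i" "Suc (nat i) < n" using that by auto
    then show ?thesis using strict[of "nat i"] by simp
  qed
  moreover have "g \<omega> m (int n - 1) \<le> g \<omega> m (int n)"
  proof (cases n)
    case 0
    then show ?thesis using g0 by simp
  next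
    case (Suc k)
    then show ?thesis using least[of k] by (simp add: D_def add.commute)
  qed
  moreover have "g \<omega> m (i + 1) < g \<omega> m i" if "i \<in> {int n..<int m + 1}" for i
  proof -
    have "int (nat i) = i" "n \<le> nat i" "nat i \<le> m" using that by auto
    then show ?thesis using fall[of "nat i"] unfolding D_def by simp
  qed
  ultimately show "\<exists>r\<^sub>0. is_peak \<omega> m r\<^sub>0"
    using nm by (intro exI[of _ "int n"]) (auto simp: is_peak_def rising_chain_def falling_chain_def)
next
  have no_lt: False if "is_peak \<omega> m a" "is_peak \<omega> m b" "a < b" for a b
  proof -
    have "g \<omega> m (b - 1) > g \<omega> m (b - 1 + 1)"
      using that unfolding is_peak_def falling_chain_def by (elim conjE ballE[of _ _ "b - 1"]) auto
    moreover have "g \<omega> m (b - 1) \<le> g \<omega> m b"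
      using that unfolding is_peak_def rising_chain_def by blast
    ultimately show False by simp
  qed
  show "a = b" if "is_peak \<omega> m a" "is_peak \<omega> m b" for a b :: int
    using no_lt that by (meson linorder_neqE)
qed

end

theory Submission
  imports Defs
begin

text \<open>
  Write \<open>s k\<close> for \<open>binom_psum m k\<close>. Comparing \<open>g k\<close> with \<open>g (k + 1)\<close> amounts to comparing
  \<open>(m choose (k + 1)) / s k\<close> with \<open>\<omega> - 1\<close>, and unimodality turns the location of the peak into
  two such comparisons: no descent from \<open>r' - 1\<close> to \<open>r'\<close>, and, if \<open>r' < m\<close>, a
  descent from \<open>r' + 1\<close> to \<open>r' + 2\<close>. With
  \<open>d = m - 2 * k\<close>, \<open>k + 1\<close> times the quotient has a finite continued fraction that begins
    \<open>(k + 1) * (m choose (k + 1)) / s k = d + 2 * k / (d + 3 + 4 * (k - 1) / (d + 6 + \<dots>))\<close>.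
  Its first two truncations bound this product from below by \<open>d\<close> and from above by
  \<open>d + 2 * k / (d + 3)\<close>, the latter if \<open>d + 3 > 0\<close>; with denominators cleared, both have
  direct proofs by induction on \<open>k\<close> (\<open>psum_lower_truncation\<close> and
  \<open>psum_upper_truncation\<close>).

  The lower bound gives the first comparison at once. For the second, put \<open>k = r' + 1\<close>; then
  \<open>k\<close> exceeds \<open>(m + 2) / (\<omega> + 1)\<close> by at most one. Were \<open>k\<close> equal to that quotient, the upper
  bound would yield the comparison because of
  \<open>(\<omega> - 1) * (\<omega> + 1) \<ge> 2\<close>, that is, \<open>\<omega> \<ge> sqrt 3\<close>. The rounding of \<open>k\<close> costs an
  amount bounded independently of \<open>k\<close>, which is absorbed for \<open>k \<ge> 5\<close> by a term linear in \<open>k\<close>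
  (\<open>truncation_bound_large\<close>); for \<open>k \<le> 4\<close> integrality of \<open>m - 2 * k\<close> helps
  (\<open>truncation_bound_small\<close>), and the case \<open>m = 4\<close>, \<open>k = 3\<close>, in which the truncation is too
  coarse, is computed.
\<close>

section \<open>Truncations of the continued fraction for partial sums of binomials\<close>

lemma Suc_times_choose_Suc:
  "int (Suc k) * int (m choose Suc k) = (int m - int k) * int (m choose k)"
proof (cases "k \<le> m")
  case True
  have "Suc k * (m choose Suc k) = (m - k) * (m choose k)"
    by (simp only: binomial_absorption binomial_absorb_comp)
  then show ?thesis
    using True by (metis of_nat_diff of_nat_mult)
qed (simp add: binomial_eq_0)

lemma psum_lower_truncation:
  "(int m - 2 * int k) * int (binom_psum m k) \<le> int (Suc k) * int (m choose Suc k)"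
proof (induction k)
  case 0
  then show ?case by (simp add: binom_psum_def)
next
  case (Suc k)
  let ?d = "int m - 2 * int k" and ?s = "int (binom_psum m k)" and ?c = "int (m choose Suc k)"
  have "(?d - 2) * (?s + ?c) \<le> ?d * ?s + (?d - 2) * ?c"
    by (simp add: algebra_simps del: binomial_Suc_Suc)
  also have "\<dots> \<le> int (Suc k) * ?c + (?d - 2) * ?c"
    using Suc.IH by simp
  also have "\<dots> = (int m - int (Suc k)) * ?c"
    by (simp add: algebra_simps del: binomial_Suc_Suc)
  finally show ?case
    unfolding Suc_times_choose_Suc[of "Suc k"] binom_psum_Suc
    by (simp add: algebra_simps del: binomial_Suc_Suc)
qed

text \<open>
  The left-hand side is the numerator of \<open>d + 2 * k / (d + 3)\<close>. The bound holds because no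
  integer lies strictly between the roots \<open>-2\<close> and \<open>-1\<close> of \<open>d * (d + 3) + 2\<close>; it fails
  for real \<open>d\<close>.
\<close>

lemma truncation_numerator_ge:
  fixes d k :: int
  shows "d * (d + 3) + 2 * k \<ge> 2 * k - 2"
proof -
  have "(d + 1) * (d + 2) \<ge> 0"
    by (cases "d \<ge> -1") (auto intro: mult_nonneg_nonneg mult_nonpos_nonpos)
  then show ?thesis by (simp add: algebra_simps)
qed

text \<open>
  The induction hypothesis for \<open>k\<close> serves only if \<open>Suc k < m\<close>, when its factor
  \<open>d * (d + 3) + 2 * k\<close> is positive and can be cancelled; otherwise the new
  left-hand side vanishes. The step comes down to a polynomial identity whose defect is \<open>8 * k * (k + 1)\<close>.
\<close>

lemma psum_upper_truncation:
  fixes m k :: nat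
  defines "d \<equiv> int m - 2 * int k"
  shows "int (Suc k) * int (m choose Suc k) * (d + 3)
    \<le> int (binom_psum m k) * (d * (d + 3) + 2 * int k)"
  unfolding d_def
proof (induction k)
  case 0
  then show ?case by (simp add: binom_psum_def)
next
  case (Suc k)
  define d where "d = int m - 2 * int k"
  define s where "s = int (binom_psum m k)"
  define c where "c = int (m choose Suc k)"
  define P where "P = d * (d + 3) + 2 * int k"
  define P' where "P' = (d - 2) * (d + 1) + 2 * int (Suc k)"
  have P'_nonneg: "P' \<ge> 0"
    using truncation_numerator_ge[of "int (Suc k)" "d - 2"] by (simp add: P'_def algebra_simps)
  have c_nonneg: "c \<ge> 0" by (simp add: c_def)
  have IH: "int (Suc k) * c * (d + 3) \<le> s * P"
    using Suc.IH by (simp add: d_def s_def c_def P_def)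
  have "(int m - int (Suc k)) * c * (d + 1) \<le> (s + c) * P'"
  proof (cases "Suc k < m")
    case True
    have P_pos: "P > 0"
    proof (cases "k \<ge> 2")
      case True
      then show ?thesis
        using truncation_numerator_ge[of "int k" d] by (simp add: P_def)
    next
      case False
      then have "d \<ge> 0 \<and> (d > 0 \<or> k > 0)" using True by (auto simp: d_def)
      then show ?thesis
        unfolding P_def by (metis add_nonneg_pos add_pos_nonneg mult_nonneg_nonneg mult_pos_pos
            of_nat_0_le_iff of_nat_0_less_iff zero_less_numeral zero_le_numeral add_nonneg_nonneg)
    qed
    have m: "int m = d + 2 * int k" by (simp add: d_def)
    have "P' * (int (Suc k) * (d + 3) + P) - (int m - int (Suc k)) * (d + 1) * P
        = 8 * int k * (int k + 1)"
      unfolding P_def P'_def m by (simp add: algebra_simps)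
    then have "(int m - int (Suc k)) * (d + 1) * P \<le> P' * (int (Suc k) * (d + 3) + P)"
      by (smt (verit) of_nat_0_le_iff mult_nonneg_nonneg)
    then have "c * ((int m - int (Suc k)) * (d + 1) * P)
        \<le> c * (P' * (int (Suc k) * (d + 3) + P))"
      using c_nonneg by (rule mult_left_mono)
    also have "\<dots> = P' * (int (Suc k) * c * (d + 3) + c * P)"
      by (simp add: algebra_simps)
    also have "\<dots> \<le> P' * (s * P + c * P)"
      using IH P'_nonneg by (intro mult_left_mono) auto
    finally have "((int m - int (Suc k)) * c * (d + 1)) * P \<le> ((s + c) * P') * P"
      by (simp add: algebra_simps)
    then show ?thesis using P_pos mult_le_cancel_right_pos by blast
  next
    case False
    then have "(int m - int (Suc k)) * c = 0"
      by (cases "m = Suc k") (auto simp: c_def binomial_eq_0)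
    moreover have "(s + c) * P' \<ge> 0"
      using P'_nonneg c_nonneg by (simp add: s_def)
    ultimately show ?thesis by (metis mult_zero_left)
  qed
  moreover have "int m - 2 * int (Suc k) = d - 2" "d - 2 + 3 = d + 1" by (simp_all add: d_def)
  ultimately show ?case
    unfolding Suc_times_choose_Suc[of "Suc k"] binom_psum_Suc s_def c_def P'_def
    by (simp only: of_nat_add)
qed

section \<open>The upper truncation lies below the threshold\<close>

text \<open>
  In this section \<open>u = \<omega> - 1\<close> and \<open>e = m - 2 * k + 2\<close>, so that \<open>d = e - 2\<close>. The choice
  \<open>k = r' + 1\<close> confines \<open>e\<close> to \<open>u * (k - 1) - 2 \<le> e < u * k\<close>. The inequality says that
  \<open>d + 2 * k / (d + 3)\<close> is less than \<open>u * (k + 1)\<close>, provided \<open>d + 3 > 0\<close>.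
\<close>

lemma truncation_bound_large:
  fixes u k e :: real
  assumes u: "u > 0" "u\<^sup>2 + 2 * u \<ge> 2" and k: "k \<ge> 5"
    and e: "e < u * k" "u * (k - 1) - 2 \<le> e"
  shows "(e - 2) * (e + 1) + 2 * k < u * (k + 1) * (e + 1)"
proof -
  define t where "t = u * k - e"
  define A where "A = k * (u\<^sup>2 + 2 * u - 2) + u + 2"
  have t: "0 < t" "t \<le> u + 2" using e by (auto simp: t_def algebra_simps)
  have A_pos: "A > 0" using u k by (simp add: A_def add_nonneg_pos)
  have slack: "u * (k + 1) * (e + 1) - ((e - 2) * (e + 1) + 2 * k) = A + t * (e - u - 1)"
    by (simp add: A_def t_def algebra_simps power2_eq_square)
  have "A + t * (e - u - 1) > 0"
  proof (cases "e \<ge> u + 1")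
    case True
    then have "t * (e - u - 1) \<ge> 0" using t by (intro mult_nonneg_nonneg) auto
    then show ?thesis using A_pos by linarith
  next
    case False
    \<comment> \<open>The slack is a concave function of \<open>e\<close>; this is its value at the lower end of the range.\<close>
    have "A + (u + 2) * (u * k - 2 * u - 3)
        = (k - 5) * (2 * (u\<^sup>2 + 2 * u - 2) + 2) + 7 * (u\<^sup>2 + 2 * u - 2) + u\<^sup>2"
      by (simp add: A_def algebra_simps power2_eq_square)
    moreover have "(k - 5) * (2 * (u\<^sup>2 + 2 * u - 2) + 2) \<ge> 0"
      using u k by (intro mult_nonneg_nonneg) auto
    moreover have "7 * (u\<^sup>2 + 2 * u - 2) \<ge> 0" "u\<^sup>2 > 0" using u by auto
    ultimately have "A + (u + 2) * (u * k - 2 * u - 3) > 0"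
      by (metis add_nonneg_nonneg add_nonneg_pos)
    moreover have "(u + 2) * (u * k - 2 * u - 3) \<le> (u + 2) * (e - u - 1)"
      using u e by (intro mult_left_mono) (auto simp: algebra_simps)
    moreover have "(u + 2) * (e - u - 1) \<le> t * (e - u - 1)"
      using t False by (intro mult_right_mono_neg) auto
    ultimately show ?thesis by linarith
  qed
  then show ?thesis using slack by linarith
qed

lemma truncation_bound_small:
  fixes u k e :: real
  assumes "u > 2 / 3" "0 < k" "k \<le> 4" "1 \<le> e" "e < u * k"
  shows "(e - 2) * (e + 1) + 2 * k < u * (k + 1) * (e + 1)"
proof -
  \<comment> \<open>The expansion is around \<open>e = 1\<close>, where the slack is \<open>2 * (u * (k + 1) - (k - 1))\<close>.\<close>
  have "u * (k + 1) * (e + 1) - ((e - 2) * (e + 1) + 2 * k)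
      = 2 * (u * (k + 1) - (k - 1)) + (e - 1) * (u * (k + 1) - e)"
    by (simp add: algebra_simps)
  moreover have "(e - 1) * (u * (k + 1) - e) \<ge> 0"
    using assms by (intro mult_nonneg_nonneg) (auto simp: algebra_simps)
  moreover have "(2 / 3) * (k + 1) < u * (k + 1)"
    using assms by (intro mult_strict_right_mono) auto
  ultimately show ?thesis using assms by argo
qed

section \<open>Location of the peak\<close>

lemma choose_ge_below_threshold:
  assumes "real (Suc k) * (\<omega> + 1) \<le> real m + 2"
  shows "(\<omega> - 1) * real (binom_psum m k) \<le> real (m choose Suc k)"
proof -
  have "real (Suc k) * (\<omega> - 1) \<le> real m - 2 * real k"
    using assms by (simp add: algebra_simps)
  then have "real (Suc k) * (\<omega> - 1) * real (binom_psum m k)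
      \<le> (real m - 2 * real k) * real (binom_psum m k)"
    by (rule mult_right_mono) simp
  also have "\<dots> = real_of_int ((int m - 2 * int k) * int (binom_psum m k))" by simp
  also have "\<dots> \<le> real_of_int (int (Suc k) * int (m choose Suc k))"
    using psum_lower_truncation by (simp only: of_int_le_iff)
  also have "\<dots> = real (Suc k) * real (m choose Suc k)"
    by (simp only: of_int_mult of_int_of_nat_eq)
  finally have "real (Suc k) * ((\<omega> - 1) * real (binom_psum m k))
      \<le> real (Suc k) * real (m choose Suc k)"
    by (simp only: mult.assoc)
  then show ?thesis
    by (subst (asm) mult_le_cancel_left_pos) (simp_all del: binomial_Suc_Suc)
qed

lemma choose_less_above_threshold:
  assumes \<omega>: "\<omega> \<ge> sqrt 3" and k: "0 < k" "k \<le> m"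
    and above: "real m + 2 < real k * (\<omega> + 1)"
    and near: "(real k - 1) * (\<omega> + 1) \<le> real m + 2"
  shows "real (m choose Suc k) < (\<omega> - 1) * real (binom_psum m k)"
proof -
  define u where "u = \<omega> - 1"
  define e where "e = int m - 2 * int k + 2"
  have s_pos: "real (binom_psum m k) > 0" using binom_psum_pos by simp
  have "(5 / 3 :: real) < sqrt 3" by (rule real_less_rsqrt) (simp add: power2_eq_square)
  then have u: "u > 2 / 3" using \<omega> by (simp add: u_def)
  have "(sqrt 3)\<^sup>2 \<le> \<omega>\<^sup>2" using \<omega> by (intro power_mono) auto
  then have u2: "u\<^sup>2 + 2 * u \<ge> 2" by (simp add: u_def algebra_simps power2_eq_square)
  have e_upper: "real_of_int e < u * real k"
    using above by (simp add: e_def u_def algebra_simps)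
  have e_lower: "u * (real k - 1) - 2 \<le> real_of_int e"
    using near by (simp add: e_def u_def algebra_simps)
  consider "k = m" | "m = 4" "k = 3" | "k < m" "\<not> (m = 4 \<and> k = 3)" using k by fastforce
  then show ?thesis
  proof cases
    case 1
    then show ?thesis using u s_pos by (simp add: u_def binomial_eq_0)
  next
    case 2
    have "binom_psum 4 3 = 15" by (simp add: binom_psum_def eval_nat_numeral)
    then show ?thesis using 2 u by (simp add: u_def eval_nat_numeral)
  next
    case 3
    have e_ge: "e \<ge> 1"
    proof (cases "k \<le> 3")
      case True
      then show ?thesis using 3 k by (auto simp: e_def)
    next
      case False
      then have "u * 3 \<le> u * (real k - 1)"
        using u by (intro mult_left_mono) auto
      then show ?thesis using u e_lower by linarith
    qed
    have bound: "(real_of_int e - 2) * (real_of_int e + 1) + 2 * real k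
        < u * (real k + 1) * (real_of_int e + 1)"
    proof (cases "k \<le> 4")
      case True
      then show ?thesis using u k e_ge e_upper by (intro truncation_bound_small) auto
    next
      case False
      then show ?thesis using u u2 e_upper e_lower by (intro truncation_bound_large) auto
    qed
    have d: "int m - 2 * int k = e - 2" by (simp add: e_def)
    have "int (Suc k) * int (m choose Suc k) * (e + 1)
        \<le> int (binom_psum m k) * ((e - 2) * (e + 1) + 2 * int k)"
      using psum_upper_truncation[of k m] unfolding d by (simp add: algebra_simps del: binomial_Suc_Suc)
    then have "real_of_int (int (Suc k) * int (m choose Suc k) * (e + 1))
        \<le> real_of_int (int (binom_psum m k) * ((e - 2) * (e + 1) + 2 * int k))"
      by (simp only: of_int_le_iff)
    then have "real (Suc k) * real (m choose Suc k) * (real_of_int e + 1)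
        \<le> real (binom_psum m k) * ((real_of_int e - 2) * (real_of_int e + 1) + 2 * real k)"
      by (simp del: binomial_Suc_Suc)
    also have "\<dots> < real (binom_psum m k) * (u * (real k + 1) * (real_of_int e + 1))"
      using bound s_pos by (rule mult_strict_left_mono)
    finally have "real (m choose Suc k) * (real (Suc k) * (real_of_int e + 1))
        < u * real (binom_psum m k) * (real (Suc k) * (real_of_int e + 1))"
      by (simp add: algebra_simps del: binomial_Suc_Suc)
    moreover have "real (Suc k) * (real_of_int e + 1) > 0" using e_ge by simp
    ultimately show ?thesis
      unfolding u_def using mult_less_cancel_right_pos by blast
  qed
qed

lemma rising_chain_le:
  assumes "rising_chain f a r" "a \<le> i" "i < r"
  shows "f i \<le> f (i + 1)"
proof (cases "i = r - 1")
  case False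
  then have "i \<in> {a..<r - 1}" using assms by auto
  then show ?thesis using assms unfolding rising_chain_def by (meson less_imp_le)
qed (use assms in \<open>simp add: rising_chain_def\<close>)

lemma rising_chain_restrict:
  assumes "rising_chain f a r" "a < r'" "r' \<le> r" "a \<le> b"
  shows "rising_chain f b r'"
  using assms rising_chain_le[of f a r "r' - 1"] by (auto simp: rising_chain_def)

theorem theorem1p3:
  fixes \<omega> :: real and m :: nat and r' r\<^sub>0 :: int
  assumes "\<omega> \<ge> sqrt 3"
    and "r' = \<lfloor>(real m + 2) / (\<omega> + 1)\<rfloor>"
    and "is_peak \<omega> m r\<^sub>0"
  shows "r\<^sub>0 \<in> {r', r' + 1} \<and>
    rising_chain (g \<omega> m) 0 r' \<and> falling_chain (g \<omega> m) (r' + 1) (int m)"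
proof -
  have "(1 :: real) < sqrt 3" by simp
  then have \<omega>: "\<omega> > 1" using assms(1) by linarith
  have r0: "0 \<le> r\<^sub>0" "r\<^sub>0 \<le> int m"
    and rise: "rising_chain (g \<omega> m) (-1) r\<^sub>0"
    and fall: "falling_chain (g \<omega> m) r\<^sub>0 (int m + 1)"
    using assms(3) by (auto simp: is_peak_def)
  have r'_nonneg: "r' \<ge> 0" using \<omega> by (simp add: assms(2))
  have "real_of_int r' \<le> (real m + 2) / (\<omega> + 1)"
    by (simp add: assms(2))
  then have r'_le: "real_of_int r' * (\<omega> + 1) \<le> real m + 2"
    using \<omega> by (simp add: pos_le_divide_eq)
  have "(real m + 2) / (\<omega> + 1) < real_of_int r' + 1"
    unfolding assms(2) by linarith
  then have r'_gt: "real m + 2 < (real_of_int r' + 1) * (\<omega> + 1)"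
    using \<omega> by (simp add: pos_divide_less_eq)
  have r'_less: "r' \<le> int m + 1"
  proof -
    have "real_of_int r' * 2 \<le> real_of_int r' * (\<omega> + 1)"
      using \<omega> r'_nonneg by (intro mult_left_mono) auto
    then show ?thesis using r'_le by linarith
  qed

  have lower: "r' \<le> r\<^sub>0"
  proof (rule ccontr)
    assume "\<not> ?thesis"
    then have less: "r\<^sub>0 < r'" by simp
    define k where "k = nat (r' - 1)"
    have k: "int k = r' - 1" using less r0 by (simp add: k_def)
    then have km: "k \<le> m" using r'_less by linarith
    have "int k \<in> {r\<^sub>0..<int m + 1}" using less k km by auto
    then have "g \<omega> m (int k + 1) < g \<omega> m (int k)"
      using fall unfolding falling_chain_def by blast
    then have "real (m choose Suc k) < (\<omega> - 1) * real (binom_psum m k)"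
      using g_Suc_less_iff[of \<omega> k m] \<omega> km by (simp del: binomial_Suc_Suc)
    moreover have "real (Suc k) = real_of_int r'" using k by linarith
    ultimately show False
      using choose_ge_below_threshold[of k \<omega> m] r'_le by (simp del: binomial_Suc_Suc of_nat_Suc)
  qed

  have upper: "r\<^sub>0 \<le> r' + 1"
  proof (rule ccontr)
    assume "\<not> ?thesis"
    then have less: "r' + 1 < r\<^sub>0" by simp
    define k where "k = nat (r' + 1)"
    have k: "int k = r' + 1" using r'_nonneg by (simp add: k_def)
    then have km: "0 < k" "k \<le> m" using r'_nonneg less r0 by linarith+
    have kr: "real k = real_of_int r' + 1" using k by linarith
    have "real (m choose Suc k) < (\<omega> - 1) * real (binom_psum m k)"
      using assms(1) km r'_le r'_gt by (intro choose_less_above_threshold) (auto simp: kr)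
    then have "g \<omega> m (int k + 1) < g \<omega> m (int k)"
      using g_Suc_less_iff[of \<omega> k m] \<omega> km by simp
    moreover have "g \<omega> m (int k) \<le> g \<omega> m (int k + 1)"
      using rising_chain_le[OF rise, of "int k"] less k by simp
    ultimately show False by simp
  qed

  have "rising_chain (g \<omega> m) 0 r'"
    using r'_nonneg lower by (intro rising_chain_restrict[OF rise]) auto
  moreover have "falling_chain (g \<omega> m) (r' + 1) (int m)"
    using fall upper unfolding falling_chain_def by auto
  moreover have "r\<^sub>0 \<in> {r', r' + 1}" using lower upper by auto
  ultimately show ?thesis by blast
qed

end
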